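(* Let $g:\mathbb{R}^m\to\overline{\mathbb{R}}$ be proper and lower semicontinuous, let $A\in\mathbb{R}^{m\times n}$, and let $f(x)=g(Ax)$. Let $\bar x\in A^{-1}(\operatorname{dom} g)$ and let $\bar v\in\partial f(\bar x)$ be such that $g$ is variationally convex at $A\bar x$ for every $\bar u\in\partial g(A\bar x)$ satisfying $\bar v=A^T\bar u$. If the constraint qualification $$\ker A^T\cap\partial^\infty g(A\bar x)=\{0\}$$ is satisfied, then $f$ is variationally convex at $\bar x$ for $\bar v\in\partial f(\bar x)$.
   Context: $\overline{\mathbb{R}}=[-\infty,+\infty]$; $f$ is proper if $f>-\infty$ and $f\not\equiv+\infty$; $\operatorname{dom} f=\{x: f(x)<+\infty\}$; $A^{-1}(\cdot)$ denotes preimage under $x\mapsto Ax$. For $\bar x\in\operatorname{dom}f$: the regular subdifferential is $\widehat\partial f(\bar x)=\{v:\liminf_{x\to\bar x,\,x\ne\bar x}\frac{f(x)-f(\bar x)-\langle v,x-\bar x\rangle}{\|x-\bar x\|}\ge0\}$; the limiting subdifferential $\partial f(\bar x)$ is the set of limits $v=\lim v_k$ with $v_k\in\widehat\partial f(x_k)$, $x_k\to\bar x$, $f(x_k)\to f(\bar x)$; the horizon subdifferential $\partial^\infty f(\bar x)$ is the set of limits $v=\lim\lambda_kv_k$ with $\lambda_k\downarrow0$, $v_k\in\widehat\partial f(x_k)$, $x_k\to\bar x$, $f(x_k)\to f(\bar x)$. Subdifferentials are empty off $\operatorname{dom}f$. $\operatorname{gph}\partial f=\{(x,v): v\in\partial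 f(x)\}$. Variational convexity: a proper lsc $f$ is variationally convex at $\bar x\in\operatorname{dom}f$ for $\bar v\in\partial f(\bar x)$ if there exist open convex neighborhoods $U$ of $\bar x$ and $V$ of $\bar v$, a convex lsc function $\hat f$ with values in $\overline{\mathbb{R}}$ with $\hat f\le f$ on $U$, and $\varepsilon>0$ such that $[U_\varepsilon\times V]\cap\operatorname{gph}\partial f=[U\times V]\cap\operatorname{gph}\partial\hat f$, where $U_\varepsilon=\{x\in U: f(x)<f(\bar x)+\varepsilon\}$, and moreover $f(x)=\hat f(x)$ for every $(x,v)$ in this common graph. *)

theory Defs
  imports "HOL-Analysis.Analysis"
begin

definition proper :: "('a \<Rightarrow> ereal) \<Rightarrow> bool" where
  "proper f \<longleftrightarrow> (\<forall>x. f x > -\<infinity>) \<and> (\<exists>x. f x \<noteq> \<infinity>)"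

definition domf :: "('a \<Rightarrow> ereal) \<Rightarrow> 'a set" where
  "domf f = {x. f x < \<infinity>}"

definition lsc :: "('a::topological_space \<Rightarrow> ereal) \<Rightarrow> bool" where
  "lsc f \<longleftrightarrow> (\<forall>x. f x \<le> Liminf (at x) f)"

text \<open>Convexity of an extended-real-valued function is convexity of its epigraph, which avoids
  any convention for \<open>\<infinity> + (-\<infinity>)\<close>; the value \<open>-\<infinity>\<close> is allowed.\<close>

definition epi :: "('a \<Rightarrow> ereal) \<Rightarrow> ('a \<times> real) set" where
  "epi f = {(x, r). f x \<le> ereal r}"

definition convex_fun :: "('a::real_vector \<Rightarrow> ereal) \<Rightarrow> bool" where
  "convex_fun f \<longleftrightarrow> convex (epi f)"

text \<open>The difference quotient is meaningful only where \<open>f\<close> is finite. Hence the subdifferentials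
  are empty where \<open>f x = \<infinity>\<close>, and also where \<open>f x = -\<infinity>\<close>; the latter cannot occur for proper
  \<open>f\<close>, and concerns only improper convex functions. The filter \<open>at x\<close> excludes the point \<open>x\<close>.\<close>

definition regular_subdiff :: "('a::euclidean_space \<Rightarrow> ereal) \<Rightarrow> 'a \<Rightarrow> 'a set" where
  "regular_subdiff f x =
     {v. \<bar>f x\<bar> \<noteq> \<infinity> \<and>
         Liminf (at x) (\<lambda>y. (f y - f x - ereal (v \<bullet> (y - x))) / ereal (norm (y - x))) \<ge> 0}"

definition limiting_subdiff :: "('a::euclidean_space \<Rightarrow> ereal) \<Rightarrow> 'a \<Rightarrow> 'a set" where
  "limiting_subdiff f x =
     {v. \<bar>f x\<bar> \<noteq> \<infinity> \<and>
         (\<exists>xs vs. (\<forall>k. vs k \<in> regular_subdiff f (xs k)) \<and>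
            xs \<longlonglongrightarrow> x \<and> (\<lambda>k. f (xs k)) \<longlonglongrightarrow> f x \<and> vs \<longlonglongrightarrow> v)}"

definition horizon_subdiff :: "('a::euclidean_space \<Rightarrow> ereal) \<Rightarrow> 'a \<Rightarrow> 'a set" where
  "horizon_subdiff f x =
     {v. \<bar>f x\<bar> \<noteq> \<infinity> \<and>
         (\<exists>xs vs (ls :: nat \<Rightarrow> real). (\<forall>k. vs k \<in> regular_subdiff f (xs k)) \<and>
            xs \<longlonglongrightarrow> x \<and> (\<lambda>k. f (xs k)) \<longlonglongrightarrow> f x \<and>
            (\<forall>k. ls k > 0) \<and> decseq ls \<and> ls \<longlonglongrightarrow> 0 \<and> (\<lambda>k. ls k *\<^sub>R vs k) \<longlonglongrightarrow> v)}"

definition gph_subdiff :: "('a::euclidean_space \<Rightarrow> ereal) \<Rightarrow> ('a \<times> 'a) set" where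
  "gph_subdiff f = {(x, v). v \<in> limiting_subdiff f x}"

text \<open>The standing requirements on \<open>f\<close>, \<open>x\<close> and \<open>v\<close> are part of the property. The convex
  function \<open>h\<close> is defined on the whole space; only \<open>h \<le> f\<close> is restricted to \<open>U\<close>.\<close>

definition variationally_convex :: "('a::euclidean_space \<Rightarrow> ereal) \<Rightarrow> 'a \<Rightarrow> 'a \<Rightarrow> bool" where
  "variationally_convex f x v \<longleftrightarrow>
     proper f \<and> lsc f \<and> x \<in> domf f \<and> v \<in> limiting_subdiff f x \<and>
     (\<exists>U V h. \<exists>\<epsilon>::real.
        open U \<and> convex U \<and> x \<in> U \<and> open V \<and> convex V \<and> v \<in> V \<and>
        convex_fun h \<and> lsc h \<and> (\<forall>y\<in>U. h y \<le> f y) \<and> \<epsilon> > 0 \<and>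
        ({y \<in> U. f y < f x + ereal \<epsilon>} \<times> V) \<inter> gph_subdiff f = (U \<times> V) \<inter> gph_subdiff h \<and>
        (\<forall>(y, w) \<in> (U \<times> V) \<inter> gph_subdiff h. f y = h y))"

end

theory Submission
  imports Defs
begin

text \<open>Variational convexity at \<open>x\<close> for \<open>v\<close> is equivalent to the subgradient inequality
  \<open>f z \<ge> f y + w \<bullet> (z - y)\<close> holding uniformly for \<open>z\<close> near \<open>x\<close> and all regular subgradients \<open>w\<close> of \<open>f\<close>
  at \<open>y\<close> with \<open>(y, f y, w)\<close> near \<open>(x, f x, v)\<close>; conversely \<open>h\<close> is the supremum of the resulting affine
  minorants. The constraint qualification keeps subgradients \<open>u\<close> of \<open>g\<close> near \<open>A x\<close> with \<open>A\<^sup>T u\<close> near \<open>v\<close>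
  bounded, so by compactness the inequality for \<open>g\<close> is uniform over all of them. It is carried over
  to \<open>f\<close> by a fuzzy chain rule \<open>w \<approx> A\<^sup>T u\<close>, in which \<open>u\<close> is a subgradient at a point \<open>y\<close> possibly off the
  range of \<open>A\<close>; the error term \<open>u \<bullet> (A x' - y)\<close> need not be small because it has the favourable sign.\<close>

section \<open>Lower semicontinuous extended-real functions\<close>

text \<open>Passing from the punctured filter to \<open>nhds\<close> is harmless because the strict
  inequality holds at \<open>x\<close> itself. Sequences that hit their limit then need no special
  treatment.\<close>

lemma lsc_iff_eventually:
  "lsc f \<longleftrightarrow> (\<forall>x c. c < f x \<longrightarrow> (\<forall>\<^sub>F y in nhds x. c < f y))"
proof -
  have "(\<forall>\<^sub>F y in nhds x. c < f y) \<longleftrightarrow> (\<forall>\<^sub>F y in at x. c < f y)" if "c < f x" for x c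
    using that by (simp add: eventually_nhds_conv_at)
  then show ?thesis
    unfolding lsc_def le_Liminf_iff by blast
qed

lemma lsc_compose:
  assumes "lsc g" and "continuous_on UNIV \<phi>"
  shows "lsc (\<lambda>z. g (\<phi> z))"
proof -
  have "filterlim \<phi> (nhds (\<phi> x)) (nhds x)" for x
    using assms(2) by (metis continuous_on_def tendsto_at_iff_tendsto_nhds UNIV_I)
  then show ?thesis
    using assms(1) unfolding lsc_iff_eventually filterlim_iff by blast
qed

lemma lsc_add_continuous:
  fixes q :: "'a::topological_space \<Rightarrow> real"
  assumes "lsc g" and "continuous_on UNIV q"
  shows "lsc (\<lambda>z. g z + ereal (q z))"
  unfolding lsc_iff_eventually
proof (intro allI impI)
  fix x c
  assume "c < g x + ereal (q x)"
  then have "c - ereal (q x) < g x"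
    by (simp add: ereal_minus_less)
  then obtain d where d: "c - ereal (q x) < d" "d < g x"
    using dense by blast
  have "filterlim q (nhds (q x)) (nhds x)"
    using assms(2) by (metis continuous_on_def tendsto_at_iff_tendsto_nhds UNIV_I)
  then have "((\<lambda>z. d + ereal (q z)) \<longlongrightarrow> d + ereal (q x)) (nhds x)"
    by (intro tendsto_add_ereal_general) auto
  moreover have "c < d + ereal (q x)"
    using d(1) by (simp add: ereal_minus_less)
  ultimately have "\<forall>\<^sub>F z in nhds x. c < d + ereal (q z)"
    by (rule order_tendstoD)
  moreover have "\<forall>\<^sub>F z in nhds x. d < g z"
    using assms(1) d(2) unfolding lsc_iff_eventually by blast
  ultimately show "\<forall>\<^sub>F z in nhds x. c < g z + ereal (q z)"
    by eventually_elim (metis add_right_mono less_imp_le less_le_trans)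
qed

lemma lsc_SUP_continuous:
  fixes a :: "'i \<Rightarrow> 'a::topological_space \<Rightarrow> real"
  assumes "\<And>i. i \<in> I \<Longrightarrow> continuous_on UNIV (a i)"
  shows "lsc (\<lambda>z. SUP i\<in>I. ereal (a i z))"
  unfolding lsc_iff_eventually
proof (intro allI impI)
  fix x c
  assume "c < (SUP i\<in>I. ereal (a i x))"
  then obtain i where i: "i \<in> I" "c < ereal (a i x)"
    by (auto simp: less_SUP_iff)
  have "filterlim (a i) (nhds (a i x)) (nhds x)"
    using assms[OF i(1)] by (metis continuous_on_def tendsto_at_iff_tendsto_nhds UNIV_I)
  then have "((\<lambda>z. ereal (a i z)) \<longlongrightarrow> ereal (a i x)) (nhds x)"
    by simp
  then have "\<forall>\<^sub>F z in nhds x. c < ereal (a i z)"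
    using i(2) by (rule order_tendstoD)
  then show "\<forall>\<^sub>F z in nhds x. c < (SUP i\<in>I. ereal (a i z))"
    by eventually_elim (use i(1) in \<open>auto simp: less_SUP_iff\<close>)
qed

lemma lsc_sequence_le:
  assumes "lsc f" and "xs \<longlonglongrightarrow> x" and "b \<longlonglongrightarrow> B" and "\<forall>\<^sub>F k in sequentially. f (xs k) \<le> b k"
  shows "f x \<le> B"
proof (rule dense_le)
  fix c
  assume "c < f x"
  then have "\<forall>\<^sub>F y in nhds x. c < f y"
    using assms(1) unfolding lsc_iff_eventually by blast
  then have "\<forall>\<^sub>F k in sequentially. c < f (xs k)"
    using assms(2) by (rule eventually_compose_filterlim)
  with assms(4) have "\<forall>\<^sub>F k in sequentially. c \<le> b k"
    by eventually_elim auto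
  with assms(3) show "c \<le> B"
    by (rule tendsto_lowerbound) simp
qed

text \<open>Lower semicontinuity gives the lower half of the convergence, the bounds
  \<open>b\<close> the upper half. This supplies the convergence of function values that limiting
  and horizon subgradients require.\<close>

lemma lsc_tendsto:
  assumes "lsc f" and "xs \<longlonglongrightarrow> x" and "b \<longlonglongrightarrow> f x" and "\<forall>\<^sub>F k in sequentially. f (xs k) \<le> b k"
  shows "(\<lambda>k. f (xs k)) \<longlonglongrightarrow> f x"
proof (rule order_tendstoI)
  fix c
  assume "c < f x"
  then have "\<forall>\<^sub>F y in nhds x. c < f y"
    using assms(1) unfolding lsc_iff_eventually by blast
  then show "\<forall>\<^sub>F k in sequentially. c < f (xs k)"
    using assms(2) by (rule eventually_compose_filterlim)
next
  fix c
  assume "f x < c"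
  then have "\<forall>\<^sub>F k in sequentially. b k < c"
    using assms(3) by (metis order_tendstoD(2))
  with assms(4) show "\<forall>\<^sub>F k in sequentially. f (xs k) < c"
    by eventually_elim auto
qed

text \<open>Without a minimiser the open sets \<open>{y. f z < f y}\<close> with \<open>z\<close> in
  \<open>K\<close> would cover \<open>K\<close>. In a finite subcover, the centre of least value
  lies in none of the sets. Infinite values cause no trouble in this argument.\<close>

lemma lsc_attains_min:
  assumes "lsc f" and "compact K" and "K \<noteq> {}"
  shows "\<exists>y\<in>K. \<forall>z\<in>K. f y \<le> f z"
proof (rule ccontr)
  assume "\<not> ?thesis"
  then have *: "\<forall>y\<in>K. \<exists>z\<in>K. f z < f y"
    by (meson not_le)
  have op: "open {y. f z < f y}" for z
  proof (rule topological_space_class.openI)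
    fix y
    assume "y \<in> {y. f z < f y}"
    then have "\<forall>\<^sub>F y in nhds y. f z < f y"
      using assms(1) unfolding lsc_iff_eventually by blast
    then show "\<exists>T. open T \<and> y \<in> T \<and> T \<subseteq> {y. f z < f y}"
      unfolding eventually_nhds by blast
  qed
  have "K \<subseteq> (\<Union>z\<in>K. {y. f z < f y})"
    using * by blast
  then obtain Z where Z: "Z \<subseteq> K" "finite Z" "K \<subseteq> (\<Union>z\<in>Z. {y. f z < f y})"
    by (rule compactE_image[OF assms(2) op])
  have "Z \<noteq> {}"
    using Z(3) assms(3) by auto
  then obtain z0 where z0: "z0 \<in> Z" "\<And>z. z \<in> Z \<Longrightarrow> f z0 \<le> f z"
    using ex_is_arg_min_if_finite[OF Z(2), of f] by (auto simp: is_arg_min_linorder)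
  obtain z where "z \<in> Z" "f z < f z0"
    using Z(1,3) z0(1) by auto
  with z0(2) show False
    by (simp add: leD)
qed

section \<open>Regular, proximal and convex subgradients\<close>

text \<open>Multiplying by the positive norm removes the quotient of extended reals. The weak
  inequality is enough since \<open>e\<close> is arbitrary: halving it restores strictness.\<close>

lemma regular_subdiff_iff:
  "v \<in> regular_subdiff f x \<longleftrightarrow>
     \<bar>f x\<bar> \<noteq> \<infinity> \<and> (\<forall>e>0. \<forall>\<^sub>F y in at x. f x + ereal (v \<bullet> (y - x) - e * norm (y - x)) \<le> f y)"
  (is "_ \<longleftrightarrow> _ \<and> ?R")
proof (cases "\<bar>f x\<bar> = \<infinity>")
  case True
  then show ?thesis
    by (simp add: regular_subdiff_def)
next
  case False
  then obtain r where r: "f x = ereal r"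
    by (metis ereal_real)
  let ?Q = "\<lambda>y. (f y - f x - ereal (v \<bullet> (y - x))) / ereal (norm (y - x))"
  have quot: "ereal (- e) < ?Q y \<longleftrightarrow> f x + ereal (v \<bullet> (y - x) - e * norm (y - x)) < f y"
    if "y \<noteq> x" for y e
    using that by (cases "f y") (auto simp: r field_simps)
  have "0 \<le> Liminf (at x) ?Q \<longleftrightarrow> ?R"
  proof
    assume L: "0 \<le> Liminf (at x) ?Q"
    show ?R
    proof (intro allI impI)
      fix e :: real
      assume "e > 0"
      then have "\<forall>\<^sub>F y in at x. ereal (- e) < ?Q y"
        using L unfolding le_Liminf_iff by auto
      moreover have "\<forall>\<^sub>F y in at x. y \<noteq> x"
        by (simp add: eventually_at_filter)
      ultimately show "\<forall>\<^sub>F y in at x. f x + ereal (v \<bullet> (y - x) - e * norm (y - x)) \<le> f y"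
        by eventually_elim (metis quot less_imp_le)
    qed
  next
    assume R: ?R
    show "0 \<le> Liminf (at x) ?Q"
      unfolding le_Liminf_iff
    proof (intro allI impI)
      fix c :: ereal
      assume "c < 0"
      then obtain d :: real where d: "c \<le> ereal (- d)" "d > 0"
        by (cases c) (auto intro: that[of 1] that[of "- real_of_ereal c"])
      have "\<forall>\<^sub>F y in at x. f x + ereal (v \<bullet> (y - x) - d / 2 * norm (y - x)) \<le> f y"
        using R d(2) by (metis half_gt_zero)
      moreover have "\<forall>\<^sub>F y in at x. y \<noteq> x"
        by (simp add: eventually_at_filter)
      ultimately show "\<forall>\<^sub>F y in at x. c < ?Q y"
      proof eventually_elim
        case (elim y)
        have "f x + ereal (v \<bullet> (y - x) - d * norm (y - x))
            < f x + ereal (v \<bullet> (y - x) - d / 2 * norm (y - x))"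
          using elim(2) d(2) by (simp add: r)
        then have "ereal (- d) < ?Q y"
          using elim quot by (meson less_le_trans)
        then show ?case
          using d(1) by (meson le_less_trans)
      qed
    qed
  qed
  with False show ?thesis
    by (simp add: regular_subdiff_def)
qed

lemma regular_subdiff_subset_limiting:
  assumes "v \<in> regular_subdiff f x"
  shows "v \<in> limiting_subdiff f x"
  unfolding limiting_subdiff_def mem_Collect_eq
proof
  show "\<bar>f x\<bar> \<noteq> \<infinity>"
    using assms by (simp add: regular_subdiff_def)
  show "\<exists>xs vs. (\<forall>k. vs k \<in> regular_subdiff f (xs k)) \<and>
      xs \<longlonglongrightarrow> x \<and> (\<lambda>k. f (xs k)) \<longlonglongrightarrow> f x \<and> vs \<longlonglongrightarrow> v"
    using assms by (intro exI[of _ "\<lambda>_. x"] exI[of _ "\<lambda>_. v"]) simp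
qed

text \<open>A quadratic error is of smaller order than the norm. The lemma turns minimisers of
  quadratically penalised functions into regular subgradients, by expanding the square.\<close>

lemma proximal_subgradient_regular:
  assumes "\<bar>f x\<bar> \<noteq> \<infinity>" and "\<rho> > 0"
    and "\<And>y. dist y x < \<rho> \<Longrightarrow> f x + ereal (u \<bullet> (y - x) - c * (norm (y - x))\<^sup>2) \<le> f y"
  shows "u \<in> regular_subdiff f x"
  unfolding regular_subdiff_iff
proof (intro conjI allI impI assms(1))
  fix e :: real
  assume e: "e > 0"
  define \<sigma> where "\<sigma> = min \<rho> (e / (\<bar>c\<bar> + 1))"
  have \<sigma>: "\<sigma> > 0"
    using assms(2) e by (simp add: \<sigma>_def)
  show "\<forall>\<^sub>F y in at x. f x + ereal (u \<bullet> (y - x) - e * norm (y - x)) \<le> f y"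
    unfolding eventually_at
  proof (intro exI[of _ \<sigma>] conjI \<sigma> ballI impI)
    fix y
    assume "y \<noteq> x \<and> dist y x < \<sigma>"
    then have y: "dist y x < \<rho>" "norm (y - x) < e / (\<bar>c\<bar> + 1)"
      by (auto simp: \<sigma>_def dist_norm)
    have "c * norm (y - x) \<le> (\<bar>c\<bar> + 1) * norm (y - x)"
      by (intro mult_right_mono) auto
    also have "\<dots> \<le> e"
      using y(2) by (simp add: field_simps)
    finally have "c * (norm (y - x))\<^sup>2 \<le> e * norm (y - x)"
      by (simp add: power2_eq_square mult.assoc[symmetric] mult_right_mono)
    then have "f x + ereal (u \<bullet> (y - x) - e * norm (y - x))
        \<le> f x + ereal (u \<bullet> (y - x) - c * (norm (y - x))\<^sup>2)"
      by (intro add_left_mono) simp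
    with assms(3)[OF y(1)] show "f x + ereal (u \<bullet> (y - x) - e * norm (y - x)) \<le> f y"
      by (rule order_trans[rotated])
  qed
qed

text \<open>If the inequality failed at \<open>z\<close>, convexity would push \<open>h\<close>
  below the affine function by \<open>t\<close> times a positive gap along the segment from
  \<open>x\<close> to \<open>z\<close>. The subgradient permits an error of only
  \<open>e * t * norm (z - x)\<close>, and \<open>e\<close> is chosen to make this half as
  large.\<close>

lemma convex_fun_regular_subgradient:
  assumes "convex_fun h" and v: "v \<in> regular_subdiff h x"
  shows "h x + ereal (v \<bullet> (z - x)) \<le> h z"
proof (rule ccontr)
  obtain a where a: "h x = ereal a"
    using v by (metis regular_subdiff_iff ereal_real)
  assume "\<not> ?thesis"
  then have "h z < ereal (a + v \<bullet> (z - x))"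
    by (simp add: a)
  \<comment> \<open>\<open>h z\<close> may be \<open>-\<infinity>\<close>, so the gap is measured
    from a real number above it.\<close>
  then obtain r where r: "h z \<le> ereal r" "r < a + v \<bullet> (z - x)"
    by (metis ereal_dense2 less_imp_le ereal_less(1) less_ereal.simps(1))
  have "z \<noteq> x"
    using r a by auto
  define e where "e = (a + v \<bullet> (z - x) - r) / (2 * norm (z - x))"
  have e: "e > 0"
    using r(2) \<open>z \<noteq> x\<close> by (simp add: e_def)
  have "\<forall>\<^sub>F y in at x. h x + ereal (v \<bullet> (y - x) - e * norm (y - x)) \<le> h y"
    using v e unfolding regular_subdiff_iff by blast
  then obtain d where d: "d > 0"
    "\<And>y. y \<noteq> x \<Longrightarrow> dist y x < d \<Longrightarrow> h x + ereal (v \<bullet> (y - x) - e * norm (y - x)) \<le> h y"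
    unfolding eventually_at by blast
  define t where "t = min 1 (d / (2 * norm (z - x)))"
  have t: "0 < t" "t \<le> 1" "t * norm (z - x) < d"
    using d(1) \<open>z \<noteq> x\<close> by (auto simp: t_def min_def field_simps)
  let ?y = "x + t *\<^sub>R (z - x)"
  have "(x, a) \<in> epi h" "(z, r) \<in> epi h"
    using a r by (auto simp: epi_def)
  then have "(1 - t) *\<^sub>R (x, a) + t *\<^sub>R (z, r) \<in> epi h"
    using assms(1) t(1,2) unfolding convex_fun_def convex_alt by (metis less_imp_le)
  then have "h ?y \<le> ereal ((1 - t) * a + t * r)"
    by (simp add: epi_def algebra_simps)
  moreover have "h x + ereal (v \<bullet> (?y - x) - e * norm (?y - x)) \<le> h ?y"
    by (rule d(2)) (use t \<open>z \<noteq> x\<close> in \<open>auto simp: dist_norm\<close>)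
  ultimately have "h x + ereal (v \<bullet> (?y - x) - e * norm (?y - x)) \<le> ereal ((1 - t) * a + t * r)"
    by (rule order_trans[rotated])
  then have "a + t * (v \<bullet> (z - x)) - e * (t * norm (z - x)) \<le> (1 - t) * a + t * r"
    using t by (simp add: a)
  moreover have "e * (t * norm (z - x)) = t * ((a + v \<bullet> (z - x) - r) / 2)"
    using \<open>z \<noteq> x\<close> by (simp add: e_def)
  moreover have "(1 - t) * a + t * r = a + t * (v \<bullet> (z - x)) - t * (a + v \<bullet> (z - x) - r)"
    by (simp add: algebra_simps)
  ultimately have "t * ((a + v \<bullet> (z - x) - r) / 2) \<le> 0"
    by simp
  then show False
    using t r by (simp add: mult_le_0_iff)
qed

lemma convex_fun_limiting_subgradient:
  assumes "convex_fun h" and v: "v \<in> limiting_subdiff h x"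
  shows "h x + ereal (v \<bullet> (z - x)) \<le> h z"
proof -
  obtain xs vs where s: "\<And>k. vs k \<in> regular_subdiff h (xs k)" "xs \<longlonglongrightarrow> x"
    "(\<lambda>k. h (xs k)) \<longlonglongrightarrow> h x" "vs \<longlonglongrightarrow> v"
    using v unfolding limiting_subdiff_def by blast
  have "(\<lambda>k. h (xs k) + ereal (vs k \<bullet> (z - xs k))) \<longlonglongrightarrow> h x + ereal (v \<bullet> (z - x))"
    using s(2-4) by (intro tendsto_add_ereal_general tendsto_ereal tendsto_intros) auto
  then show ?thesis
    by (rule tendsto_upperbound)
      (auto intro: always_eventually convex_fun_regular_subgradient[OF assms(1) s(1)])
qed

section \<open>Variational convexity as a local subgradient inequality\<close>

text \<open>Regular subgradients are used because the fuzzy chain rule starts from them and produces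
  them. A level restriction is put on \<open>y\<close> alone; the test point \<open>z\<close> ranges
  over the full ball.\<close>

definition local_subgradient_ineq :: "('a::euclidean_space \<Rightarrow> ereal) \<Rightarrow> 'a \<Rightarrow> 'a \<Rightarrow> bool" where
  "local_subgradient_ineq f x v \<longleftrightarrow>
     (\<exists>r>0. \<forall>y w z. dist y x < r \<longrightarrow> f y < f x + ereal r \<longrightarrow> dist w v < r \<longrightarrow> dist z x < r \<longrightarrow>
        w \<in> regular_subdiff f y \<longrightarrow> f y + ereal (w \<bullet> (z - y)) \<le> f z)"

text \<open>On the common graph \<open>f\<close> and \<open>h\<close> agree, and \<open>h\<close>
  stays below \<open>f\<close> on \<open>U\<close>, so the global subgradient inequality of the
  convex \<open>h\<close> passes to \<open>f\<close>.\<close>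

lemma variationally_convex_imp_local_subgradient_ineq:
  assumes "variationally_convex f x v"
  shows "local_subgradient_ineq f x v"
proof -
  obtain U V h \<epsilon> where UV: "open U" "x \<in> U" "open V" "v \<in> V"
    and h: "convex_fun h" "\<forall>y\<in>U. h y \<le> f y" "\<epsilon> > 0"
    and gph: "({y \<in> U. f y < f x + ereal \<epsilon>} \<times> V) \<inter> gph_subdiff f = (U \<times> V) \<inter> gph_subdiff h"
    and eq: "\<forall>(y, w) \<in> (U \<times> V) \<inter> gph_subdiff h. f y = h y"
    using assms unfolding variationally_convex_def by (elim conjE exE) (rule that)
  obtain r1 r2 where r12: "r1 > 0" "ball x r1 \<subseteq> U" "r2 > 0" "ball v r2 \<subseteq> V"
    using UV by (meson open_contains_ball)
  define r where "r = min \<epsilon> (min r1 r2)"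
  have "r > 0"
    using r12 h(3) by (simp add: r_def)
  moreover have "f y + ereal (w \<bullet> (z - y)) \<le> f z"
    if y: "dist y x < r" "f y < f x + ereal r" and w: "dist w v < r" and z: "dist z x < r"
      and sub: "w \<in> regular_subdiff f y" for y w z
  proof -
    have "y \<in> U" "z \<in> U" "w \<in> V"
      using r12 y(1) w z by (auto simp: r_def dist_commute subset_iff)
    moreover have "f y < f x + ereal \<epsilon>"
      by (rule less_le_trans[OF y(2)]) (auto intro!: add_left_mono simp: r_def)
    ultimately have "(y, w) \<in> (U \<times> V) \<inter> gph_subdiff h"
      using regular_subdiff_subset_limiting[OF sub]
      unfolding gph[symmetric] by (auto simp: gph_subdiff_def)
    then have "f y = h y" "w \<in> limiting_subdiff h y"
      using eq by (auto simp: gph_subdiff_def)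
    then show ?thesis
      using convex_fun_limiting_subgradient[OF h(1)] h(2) \<open>z \<in> U\<close>
      by (metis order_trans)
  qed
  ultimately show ?thesis
    unfolding local_subgradient_ineq_def by blast
qed

text \<open>All conditions on \<open>y\<close> and \<open>w\<close> are open, so regular
  approximants eventually satisfy them and the inequality survives the limit with the same
  \<open>r\<close>.\<close>

lemma local_subgradient_ineq_limiting:
  assumes "local_subgradient_ineq f x v"
  obtains r where "r > 0"
    and "\<And>y w z. dist y x < r \<Longrightarrow> f y < f x + ereal r \<Longrightarrow> dist w v < r \<Longrightarrow> dist z x < r \<Longrightarrow>
           w \<in> limiting_subdiff f y \<Longrightarrow> f y + ereal (w \<bullet> (z - y)) \<le> f z"
proof -
  obtain r where r: "r > 0" "\<And>y w z. dist y x < r \<Longrightarrow> f y < f x + ereal r \<Longrightarrow> dist w v < r \<Longrightarrow>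
      dist z x < r \<Longrightarrow> w \<in> regular_subdiff f y \<Longrightarrow> f y + ereal (w \<bullet> (z - y)) \<le> f z"
    using assms unfolding local_subgradient_ineq_def by blast
  have "f y + ereal (w \<bullet> (z - y)) \<le> f z"
    if y: "dist y x < r" "f y < f x + ereal r" and w: "dist w v < r" and z: "dist z x < r"
      and sub: "w \<in> limiting_subdiff f y" for y w z
  proof -
    obtain ys ws where s: "\<And>k. ws k \<in> regular_subdiff f (ys k)" "ys \<longlonglongrightarrow> y"
      "(\<lambda>k. f (ys k)) \<longlonglongrightarrow> f y" "ws \<longlonglongrightarrow> w"
      using sub unfolding limiting_subdiff_def by blast
    have "(\<lambda>k. f (ys k) + ereal (ws k \<bullet> (z - ys k))) \<longlonglongrightarrow> f y + ereal (w \<bullet> (z - y))"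
      using s(2-4) by (intro tendsto_add_ereal_general tendsto_ereal tendsto_intros) auto
    moreover have "\<forall>\<^sub>F k in sequentially. dist (ys k) x < r"
      by (rule order_tendstoD(2)[OF tendsto_dist[OF s(2) tendsto_const] y(1)])
    then have "\<forall>\<^sub>F k in sequentially. f (ys k) + ereal (ws k \<bullet> (z - ys k)) \<le> f z"
      using order_tendstoD(2)[OF s(3) y(2)]
        order_tendstoD(2)[OF tendsto_dist[OF s(4) tendsto_const] w]
      by eventually_elim (auto intro: r(2) z s(1))
    ultimately show ?thesis
      by (rule tendsto_upperbound) simp
  qed
  with r(1) that show thesis
    by blast
qed

lemma power2_norm_diff:
  fixes a b :: "'a::real_inner"
  shows "(norm (a - b))\<^sup>2 = (norm a)\<^sup>2 - 2 * (a \<bullet> b) + (norm b)\<^sup>2"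
  by (simp add: power2_norm_eq_inner inner_diff_left inner_diff_right inner_commute)

text \<open>Each pair in \<open>S\<close> gives an affine minorant of \<open>f\<close> on the ball
  that is exact at its base point, so subgradients of \<open>f\<close> recorded in \<open>S\<close>
  are subgradients of the supremum \<open>h\<close>. The harder inclusion is that \<open>h\<close>
  acquires no others near \<open>(x, v)\<close>; this is \<open>key\<close>, on balls of smaller
  radius \<open>s\<close>.\<close>

lemma local_subgradient_ineq_imp_variationally_convex:
  fixes f :: "'a::euclidean_space \<Rightarrow> ereal"
  assumes "proper f" and "lsc f" and v: "v \<in> limiting_subdiff f x"
    and "local_subgradient_ineq f x v"
  shows "variationally_convex f x v"
proof -
  obtain r where r: "r > 0" "\<And>y w z. dist y x < r \<Longrightarrow> f y < f x + ereal r \<Longrightarrow> dist w v < r \<Longrightarrow>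
      dist z x < r \<Longrightarrow> w \<in> limiting_subdiff f y \<Longrightarrow> f y + ereal (w \<bullet> (z - y)) \<le> f z"
    using local_subgradient_ineq_limiting[OF assms(4)] by blast
  obtain a where a: "f x = ereal a"
    using v by (metis (mono_tags, lifting) ereal_real limiting_subdiff_def mem_Collect_eq)
  define S where "S = {(y, w). dist y x < r \<and> f y < f x + ereal r \<and> dist w v < r \<and>
    w \<in> limiting_subdiff f y}"
  \<comment> \<open>The default value of \<open>real_of_ereal\<close> never enters: limiting
    subgradients exist only where \<open>f\<close> is finite.\<close>
  define h where "h z = (SUP p\<in>S. ereal (real_of_ereal (f (fst p)) + snd p \<bullet> (z - fst p)))" for z
  have fin: "ereal (real_of_ereal (f y)) = f y" if "(y, w) \<in> S" for y w
    using that by (auto simp: S_def limiting_subdiff_def ereal_real)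
  have h_le: "h z \<le> f z" if "dist z x < r" for z
    unfolding h_def
  proof (rule SUP_least)
    fix p
    assume "p \<in> S"
    then show "ereal (real_of_ereal (f (fst p)) + snd p \<bullet> (z - fst p)) \<le> f z"
      using fin[of "fst p" "snd p"] r(2)[of "fst p" "snd p" z] that
      by (auto simp: S_def simp flip: plus_ereal.simps(1))
  qed
  have h_ge: "f y + ereal (w \<bullet> (z - y)) \<le> h z" if "(y, w) \<in> S" for y w z
    using SUP_upper[OF that, of "\<lambda>p. ereal (real_of_ereal (f (fst p)) + snd p \<bullet> (z - fst p))"]
      fin[OF that] by (simp add: h_def flip: plus_ereal.simps(1))
  have h_eq: "h y = f y" if "(y, w) \<in> S" for y w
    using h_ge[OF that, of y] h_le[of y] that by (auto simp: S_def zero_ereal_def[symmetric])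
  have h_sub: "w \<in> limiting_subdiff h y" if "(y, w) \<in> S" for y w
  \<comment> \<open>The affine minorant of \<open>h\<close> is global and exact at \<open>y\<close>,
    so any radius will do and the quadratic error is zero.\<close>
  proof (rule regular_subdiff_subset_limiting, rule proximal_subgradient_regular[of _ _ 1 _ 0])
    show "\<bar>h y\<bar> \<noteq> \<infinity>"
      using h_eq[OF that] that by (simp add: S_def limiting_subdiff_def)
  qed (use h_ge[OF that] h_eq[OF that] in auto)
  have h_convex: "convex_fun h"
  proof -
    \<comment> \<open>The epigraph of a supremum of affine functions is an intersection of closed
      half-spaces with normals \<open>(snd p, -1)\<close>.\<close>
    have "epi h = {(z, t). \<forall>p\<in>S. real_of_ereal (f (fst p)) + snd p \<bullet> (z - fst p) \<le> t}"
      by (auto simp: epi_def h_def SUP_le_iff)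
    also have "\<dots> = (\<Inter>p\<in>S. {q. (snd p, -1) \<bullet> q \<le> snd p \<bullet> fst p - real_of_ereal (f (fst p))})"
      by (force simp: inner_diff_right)
    finally show ?thesis
      unfolding convex_fun_def by (simp add: convex_INT convex_halfspace_le)
  qed
  have h_lsc: "lsc h"
    unfolding h_def by (rule lsc_SUP_continuous) (intro continuous_intros)
  \<comment> \<open>Below, the proximal point \<open>y\<close> is within \<open>4 * s\<close> of
    \<open>x\<close> and its subgradient \<open>w\<close> within \<open>6 * s\<close> of
    \<open>v\<close>; \<open>r / 16\<close> keeps both well inside their windows. The bound
    \<open>1 / 2\<close> gives \<open>norm (e + v) \<le> norm v + 1\<close>, and the last bound then
    keeps \<open>f y\<close> below level \<open>f x + r\<close>.\<close>
  define s where "s = min (r / 16) (min (1 / 2) (r / (8 * (norm v + 1))))"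
  have nv: "norm v + 1 > 0"
    by (simp add: add_nonneg_pos)
  have s: "s > 0" "s \<le> r / 16" "s \<le> 1 / 2" "s * (8 * (norm v + 1)) \<le> r"
  proof -
    show "s > 0"
      using r(1) nv by (simp add: s_def)
    show "s \<le> r / 16" "s \<le> 1 / 2"
      unfolding s_def by linarith+
    have "s \<le> r / (8 * (norm v + 1))"
      unfolding s_def by linarith
    then show "s * (8 * (norm v + 1)) \<le> r"
      using nv by (simp add: pos_le_divide_eq)
  qed
  \<comment> \<open>A proximal step produces a subgradient of \<open>f\<close> with the same sum \<open>y + w\<close>, so monotonicity
    identifies it with the given subgradient of \<open>h\<close>.\<close>
  have key: "(y0, w0) \<in> S"
    if y0: "dist y0 x < s" and w0: "dist w0 v < s" and sub: "w0 \<in> limiting_subdiff h y0" for y0 w0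
  proof -
    define p where "p = y0 + w0"
    define q where "q y = (norm (y - p))\<^sup>2 / 2" for y
    have "lsc (\<lambda>y. f y + ereal (q y))"
      unfolding q_def by (intro lsc_add_continuous assms(2) continuous_intros) auto
    moreover have "cball x (r / 2) \<noteq> {}"
      using r(1) by simp
    ultimately obtain y where y: "y \<in> cball x (r / 2)"
      and min: "\<And>z. z \<in> cball x (r / 2) \<Longrightarrow> f y + ereal (q y) \<le> f z + ereal (q z)"
      using lsc_attains_min[of "\<lambda>y. f y + ereal (q y)" "cball x (r / 2)"] compact_cball by blast
    have min_x: "f y + ereal (q y) \<le> ereal (a + q x)"
      using min[of x] r(1) by (simp add: a)
    then obtain b where b: "f y = ereal b"
      using assms(1) by (cases "f y") (auto simp: proper_def)
    \<comment> \<open>Minimality tested against \<open>x\<close> bounds \<open>f y\<close> above,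
      and the subgradient inequality for \<open>v\<close> at \<open>x\<close> bounds it below. The
      terms in \<open>v\<close> cancel, leaving
      \<open>(norm d)\<^sup>2 / 2 \<le> d \<bullet> e\<close>, hence
      \<open>norm d \<le> 2 * norm e\<close>.\<close>
    define d where "d = y - x"
    define e where "e = p - x - v"
    define w where "w = p - y"
    have "e = (y0 - x) + (w0 - v)"
      by (simp add: e_def p_def)
    then have e: "norm e \<le> 2 * s"
      using norm_triangle_ineq[of "y0 - x" "w0 - v"] y0 w0 by (simp add: dist_norm)
    have yr: "dist y x < r"
      using y r(1) by (simp add: dist_commute)
    have "f x + ereal (v \<bullet> d) \<le> f y"
      unfolding d_def by (rule r(2)) (use r(1) yr v a in auto)
    then have low: "a + v \<bullet> d \<le> b"
      by (simp add: a b)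
    have "q y = q x + (norm d)\<^sup>2 / 2 - d \<bullet> (e + v)"
    proof -
      have eqs: "y - p = d - (e + v)" "x - p = - (e + v)"
        by (auto simp: d_def e_def)
      show ?thesis
        unfolding q_def eqs power2_norm_diff norm_minus_cancel by (simp add: field_simps)
    qed
    then have up: "b + (norm d)\<^sup>2 / 2 \<le> a + d \<bullet> e + d \<bullet> v"
      using min_x by (simp add: b inner_add_right)
    have "(norm d)\<^sup>2 / 2 \<le> d \<bullet> e"
      using up low by (simp add: inner_commute)
    also have "\<dots> \<le> norm d * norm e"
      by (rule norm_cauchy_schwarz)
    finally have "norm d * norm d \<le> norm d * (2 * norm e)"
      by (simp add: power2_eq_square)
    then have "norm d \<le> 2 * norm e"
      by (cases "d = 0") auto
    then have d: "norm d \<le> 4 * s"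
      using e by simp
    have "b - a \<le> d \<bullet> (e + v)"
      using up zero_le_power2[of "norm d"] unfolding inner_add_right by linarith
    also have "\<dots> \<le> norm d * norm (e + v)"
      by (rule norm_cauchy_schwarz)
    also have "\<dots> \<le> (4 * s) * (norm v + 1)"
      using d e s norm_triangle_ineq[of e v] by (intro mult_mono) auto
    also have "\<dots> < r"
      using s(4) r(1) by (simp add: algebra_simps)
    finally have br: "f y < f x + ereal r"
      by (simp add: a b)
    have "w - v = e - d"
      by (simp add: w_def e_def d_def)
    then have wv: "dist w v < r"
      using d e s(1,2) r(1) norm_triangle_ineq4[of e d] by (simp add: dist_norm)
    \<comment> \<open>The radius keeps competitors in the ball of radius \<open>r / 2\<close>, so
      its boundary is not felt. With \<open>w = p - y\<close>, expanding the squares turns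
      minimality into the proximal inequality.\<close>
    have "w \<in> regular_subdiff f y"
    proof (rule proximal_subgradient_regular[of _ _ "r / 2 - norm d" _ "1 / 2"])
      show "\<bar>f y\<bar> \<noteq> \<infinity>"
        by (simp add: b)
      show "0 < r / 2 - norm d"
        using d s(2) r(1) by simp
      fix z
      assume "dist z y < r / 2 - norm d"
      then have "z \<in> cball x (r / 2)"
        using dist_triangle[of x z y] by (simp add: d_def dist_norm norm_minus_commute)
      from min[OF this] have "ereal (b + q y) \<le> f z + ereal (q z)"
        by (simp add: b)
      moreover have "q y - q z = w \<bullet> (z - y) - 1 / 2 * (norm (z - y))\<^sup>2"
      proof -
        have eqs: "z - p = (z - y) - w" "y - p = - w"
          by (auto simp: w_def)
        show ?thesis
          unfolding q_def eqs power2_norm_diff[of "z - y" w] norm_minus_cancel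
          by (simp add: inner_commute field_simps)
      qed
      ultimately show "f y + ereal (w \<bullet> (z - y) - 1 / 2 * (norm (z - y))\<^sup>2) \<le> f z"
        by (cases "f z") (auto simp: b)
    qed
    then have yw: "(y, w) \<in> S"
      using yr br wv regular_subdiff_subset_limiting by (auto simp: S_def)
    \<comment> \<open>The inequalities of \<open>h\<close> at \<open>y\<close> and at
      \<open>y0\<close> add up to monotonicity. Since \<open>w - w0 = y0 - y\<close>, it says that
      the square of \<open>norm (y0 - y)\<close> is at most zero.\<close>
    have "ereal (b + w \<bullet> (y0 - y)) \<le> h y0"
      using h_ge[OF yw, of y0] by (simp add: b)
    moreover have "h y0 + ereal (w0 \<bullet> (y - y0)) \<le> ereal b"
      using convex_fun_limiting_subgradient[OF h_convex sub, of y] h_eq[OF yw] by (simp add: b)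
    ultimately have "w \<bullet> (y0 - y) + w0 \<bullet> (y - y0) \<le> 0"
      by (cases "h y0") auto
    moreover have "w = w0 + (y0 - y)"
      by (simp add: w_def p_def)
    ultimately have "(y0 - y) \<bullet> (y0 - y) \<le> 0"
      by (simp add: inner_add_left inner_diff_right algebra_simps)
    then have "y0 = y"
      by (metis inner_ge_zero inner_eq_zero_iff order_antisym right_minus_eq)
    with yw \<open>w = w0 + (y0 - y)\<close> show ?thesis
      by simp
  qed
  \<comment> \<open>Only the balls shrink to \<open>s\<close>. The level window keeps the width
    \<open>r\<close> recorded in \<open>S\<close>, so \<open>r\<close> serves as the final
    \<open>\<epsilon>\<close>.\<close>
  have gph: "({y \<in> ball x s. f y < f x + ereal r} \<times> ball v s) \<inter> gph_subdiff f
      = (ball x s \<times> ball v s) \<inter> gph_subdiff h" (is "?L = ?R")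
  proof (intro subset_antisym subrelI)
    fix y w
    assume "(y, w) \<in> ?L"
    moreover from this have "(y, w) \<in> S"
      using s(2) r(1) by (auto simp: S_def gph_subdiff_def dist_commute)
    ultimately show "(y, w) \<in> ?R"
      using h_sub by (auto simp: gph_subdiff_def)
  next
    fix y w
    assume "(y, w) \<in> ?R"
    moreover from this have "(y, w) \<in> S"
      by (intro key) (auto simp: gph_subdiff_def dist_commute)
    ultimately show "(y, w) \<in> ?L"
      by (auto simp: gph_subdiff_def S_def)
  qed
  have "f y = h y" if "(y, w) \<in> (ball x s \<times> ball v s) \<inter> gph_subdiff h" for y w
    using key[of y w] h_eq[of y w] that by (auto simp: gph_subdiff_def dist_commute)
  then have eq: "\<forall>(y, w) \<in> (ball x s \<times> ball v s) \<inter> gph_subdiff h. f y = h y"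
    by blast
  have "x \<in> domf f"
    by (simp add: domf_def a)
  moreover have "\<forall>y\<in>ball x s. h y \<le> f y"
    using h_le s(2) r(1) by (auto simp: dist_commute)
  ultimately show ?thesis
    unfolding variationally_convex_def
    using assms(1-3) h_convex h_lsc r(1) s(1) gph eq
    by (intro conjI exI[of _ "ball x s"] exI[of _ "ball v s"] exI[of _ h] exI[of _ r]) auto
qed

section \<open>Uniformity from the constraint qualification\<close>

text \<open>The horizon subdifferential asks for scalars decreasing to zero. They will be inverse
  norms of subgradients, so these norms must grow monotonically along the subsequence.\<close>

lemma unbounded_subsequence:
  fixes a :: "nat \<Rightarrow> real"
  assumes "\<And>B. \<exists>k. B < a k"
  obtains \<sigma> where "strict_mono \<sigma>" and "incseq (a \<circ> \<sigma>)" and "\<And>k. real k < a (\<sigma> k)"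
proof -
  have step: "\<exists>m>n. a n \<le> a m \<and> B < a m" for n B
  proof -
    \<comment> \<open>Exceeding the maximum over all indices up to \<open>n\<close> forces
      \<open>m > n\<close>.\<close>
    obtain m where m: "Max (insert B (a ` {..n})) < a m"
      using assms by blast
    then have "\<And>i. i \<le> n \<Longrightarrow> a i < a m" "B < a m"
      by (auto simp: Max_less_iff)
    then show ?thesis
      by (metis less_imp_le linorder_not_le order_less_irrefl)
  qed
  have "\<exists>\<sigma>. \<forall>k. real k < a (\<sigma> k) \<and> (\<sigma> k < \<sigma> (Suc k) \<and> a (\<sigma> k) \<le> a (\<sigma> (Suc k)))"
    by (rule dependent_nat_choice) (use step in \<open>metis+\<close>)
  then obtain \<sigma> where "\<And>k. real k < a (\<sigma> k)" "\<And>k. \<sigma> k < \<sigma> (Suc k)"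
    "\<And>k. a (\<sigma> k) \<le> a (\<sigma> (Suc k))"
    by blast
  then show thesis
    by (intro that[of \<sigma>]) (auto simp: strict_mono_Suc_iff incseq_Suc_iff)
qed

lemma LIMSEQ_dist_inverse_Suc:
  fixes s :: "nat \<Rightarrow> 'a::metric_space"
  assumes "\<And>k. dist (s k) l \<le> 1 / real (Suc k)"
  shows "s \<longlonglongrightarrow> l"
proof (subst tendsto_dist_iff, rule tendsto_sandwich[OF _ _ tendsto_const])
  show "(\<lambda>k. 1 / real (Suc k)) \<longlonglongrightarrow> 0"
    using LIMSEQ_inverse_real_of_nat by (simp add: inverse_eq_divide)
  show "\<forall>\<^sub>F k in sequentially. dist (s k) l \<le> 1 / real (Suc k)"
    using assms by (intro always_eventually allI)
qed simp

lemma lsc_tendsto_inverse_Suc: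
  assumes "lsc g" and "ys \<longlonglongrightarrow> y" and "\<And>k. g (ys k) \<le> g y + ereal (1 / real (Suc k))"
  shows "(\<lambda>k. g (ys k)) \<longlonglongrightarrow> g y"
proof (rule lsc_tendsto[OF assms(1,2)])
  have "(\<lambda>k. 1 / real (Suc k)) \<longlonglongrightarrow> 0"
    using LIMSEQ_inverse_real_of_nat by (simp add: inverse_eq_divide)
  then have "(\<lambda>k. g y + ereal (1 / real (Suc k))) \<longlonglongrightarrow> g y + ereal 0"
    by (intro tendsto_add_ereal_general tendsto_ereal tendsto_const) auto
  then show "(\<lambda>k. g y + ereal (1 / real (Suc k))) \<longlonglongrightarrow> g y"
    by (simp add: zero_ereal_def[symmetric] del: of_nat_Suc)
qed (intro always_eventually allI assms(3))

text \<open>Take violations in windows shrinking to \<open>y0\<close> and \<open>v\<close>. If their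
  subgradients were unbounded, normalising would give a unit horizon subgradient in the kernel of
  \<open>L\<close>. So a subsequence converges to some limiting subgradient \<open>u\<close> with
  \<open>L u = v\<close>, and the inequality near \<open>u\<close> contradicts the
  violations.\<close>

lemma uniform_local_subgradient_ineq:
  fixes g :: "'b::euclidean_space \<Rightarrow> ereal" and L :: "'b \<Rightarrow> 'a::euclidean_space"
  assumes "lsc g" and "linear L" and fin: "\<bar>g y0\<bar> \<noteq> \<infinity>"
    and loc: "\<And>u. u \<in> limiting_subdiff g y0 \<Longrightarrow> L u = v \<Longrightarrow> local_subgradient_ineq g y0 u"
    and cq: "\<And>u. u \<in> horizon_subdiff g y0 \<Longrightarrow> L u = 0 \<Longrightarrow> u = 0"
  obtains \<delta> where "\<delta> > 0"
    and "\<And>y u z. dist y y0 < \<delta> \<Longrightarrow> g y < g y0 + ereal \<delta> \<Longrightarrow> dist (L u) v < \<delta> \<Longrightarrow> dist z y0 < \<delta> \<Longrightarrow>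
           u \<in> regular_subdiff g y \<Longrightarrow> g y + ereal (u \<bullet> (z - y)) \<le> g z"
proof -
  have contL: "(\<lambda>k. L (s k)) \<longlonglongrightarrow> L l" if "s \<longlonglongrightarrow> l" for s l
    using that assms(2) by (simp add: linear_continuous_at linear_conv_bounded_linear isCont_tendsto_compose)
  define bad where "bad \<delta> y u z \<longleftrightarrow> dist y y0 < \<delta> \<and> g y < g y0 + ereal \<delta> \<and> dist (L u) v < \<delta> \<and>
    dist z y0 < \<delta> \<and> u \<in> regular_subdiff g y \<and> \<not> g y + ereal (u \<bullet> (z - y)) \<le> g z" for \<delta> y u z
  have "\<exists>\<delta>>0. \<forall>y u z. \<not> bad \<delta> y u z"
  proof (rule ccontr)
    assume "\<not> ?thesis"
    then have "\<forall>k. \<exists>y u z. bad (1 / real (Suc k)) y u z"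
      by (simp del: of_nat_Suc)
    then obtain ys us zs where bad: "\<And>k. bad (1 / real (Suc k)) (ys k) (us k) (zs k)"
      by metis
    have ys: "ys \<longlonglongrightarrow> y0" and zs: "zs \<longlonglongrightarrow> y0" and Lus: "(\<lambda>k. L (us k)) \<longlonglongrightarrow> v"
      by (rule LIMSEQ_dist_inverse_Suc; use bad in \<open>simp add: bad_def less_imp_le del: of_nat_Suc\<close>)+
    have us: "us k \<in> regular_subdiff g (ys k)" for k
      using bad by (simp add: bad_def)
    have gys: "(\<lambda>k. g (ys k)) \<longlonglongrightarrow> g y0"
      using bad by (intro lsc_tendsto_inverse_Suc[OF assms(1) ys]) (simp add: bad_def less_imp_le del: of_nat_Suc)
    have "bounded (range us)"
    proof (rule ccontr)
      assume "\<not> bounded (range us)"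
      then have "\<And>B. \<exists>k. B < norm (us k)"
        by (metis (no_types, lifting) bounded_iff image_iff not_le)
      then obtain \<sigma> where \<sigma>: "strict_mono \<sigma>" "incseq ((\<lambda>k. norm (us k)) \<circ> \<sigma>)"
        "\<And>k. real k < norm (us (\<sigma> k))"
        using unbounded_subsequence[of "\<lambda>k. norm (us k)"] by metis
      define w where "w k = inverse (norm (us (\<sigma> k))) *\<^sub>R us (\<sigma> k)" for k
      have pos: "0 < norm (us (\<sigma> k))" for k
        using \<sigma>(3)[of k] by (meson le_less_trans of_nat_0_le_iff)
      then have nw: "norm (w k) = 1" for k
        by (simp add: w_def)
      then obtain l \<tau> where \<tau>: "strict_mono \<tau>" "(w \<circ> \<tau>) \<longlonglongrightarrow> l"
        using bounded_imp_convergent_subsequence[of w] by (metis bounded_iff image_iff order_refl)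
      let ?\<rho> = "\<sigma> \<circ> \<tau>"
      have \<rho>: "strict_mono ?\<rho>"
        using \<sigma>(1) \<tau>(1) by (rule strict_mono_o)
      define ls where "ls k = inverse (norm (us (?\<rho> k)))" for k
      have w: "(\<lambda>k. ls k *\<^sub>R us (?\<rho> k)) \<longlonglongrightarrow> l"
        using \<tau>(2) by (simp add: ls_def w_def comp_def)
      have dec: "decseq ls"
      proof (rule decseq_SucI)
        fix k
        have "norm (us (\<sigma> (\<tau> k))) \<le> norm (us (\<sigma> (\<tau> (Suc k))))"
          using \<sigma>(2) \<tau>(1) by (simp add: incseq_def strict_mono_less_eq)
        then show "ls (Suc k) \<le> ls k"
          using pos by (simp add: ls_def le_imp_inverse_le)
      qed
      have lim: "ls \<longlonglongrightarrow> 0"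
      proof (rule tendsto_sandwich[OF _ _ tendsto_const lim_inverse_n])
        show "\<forall>\<^sub>F k in sequentially. ls k \<le> inverse (real k)"
          \<comment> \<open>Index 0 is left out because \<open>inverse 0 = 0\<close> is no upper
            bound for a positive number.\<close>
          using eventually_gt_at_top[of 0]
        proof eventually_elim
          case (elim k)
          have "real k \<le> real (\<tau> k)"
            using \<tau>(1) by (simp add: seq_suble)
          then have "real k \<le> norm (us (\<sigma> (\<tau> k)))"
            using \<sigma>(3) by (meson less_imp_le order_trans)
          then show ?case
            using elim by (simp add: ls_def le_imp_inverse_le)
        qed
      qed (auto simp: ls_def)
      have "l \<in> horizon_subdiff g y0"
        unfolding horizon_subdiff_def mem_Collect_eq
      proof (rule conjI[OF fin], rule exI[of _ "ys \<circ> ?\<rho>"], rule exI[of _ "us \<circ> ?\<rho>"],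
          rule exI[of _ ls], intro conjI)
        show "(ys \<circ> ?\<rho>) \<longlonglongrightarrow> y0"
          using ys \<rho> by (rule LIMSEQ_subseq_LIMSEQ)
        show "(\<lambda>k. g ((ys \<circ> ?\<rho>) k)) \<longlonglongrightarrow> g y0"
          using LIMSEQ_subseq_LIMSEQ[OF gys \<rho>] by (simp add: comp_def)
        show "(\<lambda>k. ls k *\<^sub>R (us \<circ> ?\<rho>) k) \<longlonglongrightarrow> l"
          using w by simp
      qed (use us pos dec lim in \<open>auto simp: ls_def\<close>)
      \<comment> \<open>The images \<open>L (us k)\<close> converge, so scaling them by
        \<open>ls\<close>, which tends to zero, annihilates them in the limit.\<close>
      moreover have "L l = 0"
      proof (rule LIMSEQ_unique[OF contL[OF w]])
        have "(\<lambda>k. ls k *\<^sub>R L (us (?\<rho> k))) \<longlonglongrightarrow> 0 *\<^sub>R v"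
          using LIMSEQ_subseq_LIMSEQ[OF Lus \<rho>] lim by (intro tendsto_scaleR) (auto simp: comp_def)
        then show "(\<lambda>k. L (ls k *\<^sub>R us (?\<rho> k))) \<longlonglongrightarrow> 0"
          by (simp add: linear_scale[OF assms(2)])
      qed
      ultimately have "l = 0"
        by (rule cq)
      moreover have "norm l = 1"
        by (rule LIMSEQ_unique[OF tendsto_norm[OF \<tau>(2)]]) (simp add: nw)
      ultimately show False
        by simp
    qed
    then obtain u \<tau> where \<tau>: "strict_mono \<tau>" "(us \<circ> \<tau>) \<longlonglongrightarrow> u"
      using bounded_imp_convergent_subsequence by blast
    have ys\<tau>: "(\<lambda>k. ys (\<tau> k)) \<longlonglongrightarrow> y0" and zs\<tau>: "(\<lambda>k. zs (\<tau> k)) \<longlonglongrightarrow> y0"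
      and gys\<tau>: "(\<lambda>k. g (ys (\<tau> k))) \<longlonglongrightarrow> g y0" and Lus\<tau>: "(\<lambda>k. L (us (\<tau> k))) \<longlonglongrightarrow> v"
      using LIMSEQ_subseq_LIMSEQ[OF ys \<tau>(1)] LIMSEQ_subseq_LIMSEQ[OF zs \<tau>(1)]
        LIMSEQ_subseq_LIMSEQ[OF gys \<tau>(1)] LIMSEQ_subseq_LIMSEQ[OF Lus \<tau>(1)]
      by (simp_all add: comp_def)
    have us\<tau>: "(\<lambda>k. us (\<tau> k)) \<longlonglongrightarrow> u"
      using \<tau>(2) by (simp add: comp_def)
    have "u \<in> limiting_subdiff g y0"
      unfolding limiting_subdiff_def mem_Collect_eq
      using us ys\<tau> gys\<tau> us\<tau> fin
      by (simp, rule_tac exI[of _ "\<lambda>k. ys (\<tau> k)"], rule_tac exI[of _ "\<lambda>k. us (\<tau> k)"]) simp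
    moreover have "L u = v"
      using contL[OF us\<tau>] Lus\<tau> by (rule LIMSEQ_unique)
    ultimately have "local_subgradient_ineq g y0 u"
      by (rule loc)
    then obtain r where r: "r > 0" "\<And>y w z. dist y y0 < r \<Longrightarrow> g y < g y0 + ereal r \<Longrightarrow> dist w u < r \<Longrightarrow>
        dist z y0 < r \<Longrightarrow> w \<in> regular_subdiff g y \<Longrightarrow> g y + ereal (w \<bullet> (z - y)) \<le> g z"
      unfolding local_subgradient_ineq_def by blast
    have "g y0 < g y0 + ereal r"
      using fin r(1) by (cases "g y0") auto
    from order_tendstoD(2)[OF gys\<tau> this]
    have "\<forall>\<^sub>F k in sequentially. g (ys (\<tau> k)) + ereal (us (\<tau> k) \<bullet> (zs (\<tau> k) - ys (\<tau> k))) \<le> g (zs (\<tau> k))"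
      using tendstoD[OF ys\<tau> r(1)]
        tendstoD[OF zs\<tau> r(1)] tendstoD[OF us\<tau> r(1)]
      by eventually_elim (auto intro: r(2) us)
    then obtain k where "g (ys (\<tau> k)) + ereal (us (\<tau> k) \<bullet> (zs (\<tau> k) - ys (\<tau> k))) \<le> g (zs (\<tau> k))"
      using eventually_happens'[OF sequentially_bot] by blast
    then show False
      using bad[of "\<tau> k"] by (simp add: bad_def)
  qed
  with that show thesis
    unfolding bad_def by blast
qed

section \<open>Fuzzy chain rule by penalisation\<close>

text \<open>The penalised problem of minimising \<open>g y' - v \<bullet> (x' - x) + 2e \<bar>x' - x\<bar> + k \<bar>L x' - y'\<bar>\<^sup>2 / 2\<close>
  yields \<open>u = k (L x' - y)\<close>, whence the sign in the last conclusion.\<close>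

lemma fuzzy_chain_rule:
  fixes g :: "'b::euclidean_space \<Rightarrow> ereal" and L :: "'a::euclidean_space \<Rightarrow> 'b"
  assumes "proper g" and "lsc g" and "linear L"
    and v: "v \<in> regular_subdiff (\<lambda>x. g (L x)) x" and "\<eta> > 0"
  obtains x' y u where "dist x' x < \<eta>" and "dist y (L x) < \<eta>" and "g y < g (L x) + ereal \<eta>"
    and "u \<in> regular_subdiff g y" and "norm (v - adjoint L u) \<le> \<eta>" and "0 \<le> u \<bullet> (L x' - y)"
proof -
  \<comment> \<open>The subgradient inequality costs a slack \<open>e\<close>, while the objective
    carries \<open>2 * e\<close>. The surplus forces the minimisers towards \<open>x\<close>, and
    \<open>2 * e = \<eta>\<close> is the final error in the subgradient.\<close>
  define e where "e = \<eta> / 2"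
  have e: "e > 0"
    using assms(5) by (simp add: e_def)
  obtain a where a: "g (L x) = ereal a"
    using v by (metis regular_subdiff_iff ereal_real)
  have contL: "continuous_on S L" for S
    using assms(3) by (simp add: linear_continuous_on linear_conv_bounded_linear)
  have "\<forall>\<^sub>F y in at x. g (L x) + ereal (v \<bullet> (y - x) - e * norm (y - x)) \<le> g (L y)"
    using v e unfolding regular_subdiff_iff by blast
  then obtain \<rho>' where \<rho>': "\<rho>' > 0" "\<And>y. y \<noteq> x \<Longrightarrow> dist y x < \<rho>' \<Longrightarrow>
      ereal (a + (v \<bullet> (y - x) - e * norm (y - x))) \<le> g (L y)"
    unfolding eventually_at by (auto simp: a)
  define \<rho> where "\<rho> = \<rho>' / 2"
  have \<rho>: "\<rho> > 0"
    using \<rho>'(1) by (simp add: \<rho>_def)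
  have below: "ereal (a + (v \<bullet> (y - x) - e * norm (y - x))) \<le> g (L y)" if "y \<in> cball x \<rho>" for y
    using \<rho>'(1) \<rho>'(2)[of y] that by (cases "y = x") (auto simp: a \<rho>_def dist_commute)
  define K where "K = cball x \<rho> \<times> cball (L x) \<rho>"
  have K: "compact K" "(x, L x) \<in> K"
    using \<rho> by (auto simp: K_def compact_Times)
  define q where "q k z = - (v \<bullet> (fst z - x)) + 2 * e * norm (fst z - x)
    + real k / 2 * (norm (L (fst z) - snd z))\<^sup>2" for k :: nat and z
  have "\<exists>z\<in>K. \<forall>z'\<in>K. g (snd z) + ereal (q k z) \<le> g (snd z') + ereal (q k z')" for k
  proof -
    have "continuous_on UNIV (\<lambda>z :: 'a \<times> 'b. L (fst z))"
      by (rule linear_continuous_on_compose[OF continuous_on_fst[OF continuous_on_id] assms(3)])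
    then have "continuous_on UNIV (q k)"
      unfolding q_def by (intro continuous_intros)
    then have "lsc (\<lambda>z :: 'a \<times> 'b. g (snd z) + ereal (q k z))"
      by (intro lsc_add_continuous lsc_compose[OF assms(2)] continuous_on_snd continuous_on_id)
    from lsc_attains_min[OF this K(1)] K(2) show ?thesis
      by auto
  qed
  then obtain zs where zsK: "\<And>k. zs k \<in> K"
    and zs_min: "\<And>k z'. z' \<in> K \<Longrightarrow> g (snd (zs k)) + ereal (q k (zs k)) \<le> g (snd z') + ereal (q k z')"
    by metis
  define xs ys where "xs k = fst (zs k)" and "ys k = snd (zs k)" for k
  have xs: "dist (xs k) x \<le> \<rho>" and ys: "ys k \<in> cball (L x) \<rho>" for k
    using zsK[of k] by (auto simp: K_def xs_def ys_def mem_Times_iff dist_commute)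
  \<comment> \<open>The competitor is \<open>(x, L x)\<close>, where \<open>q k\<close>
    vanishes.\<close>
  have le_a: "g (ys k) + ereal (q k (zs k)) \<le> ereal a" for k
    using zs_min[OF K(2), of k] by (simp add: a q_def ys_def)
  have "\<exists>b. g (ys k) = ereal b" for k
    using le_a[of k] assms(1) by (cases "g (ys k)") (auto simp: proper_def)
  then obtain b where b: "\<And>k. g (ys k) = ereal (b k)"
    by metis
  have b_le: "b k + real k / 2 * (norm (L (xs k) - ys k))\<^sup>2
      \<le> a + v \<bullet> (xs k - x) - 2 * e * norm (xs k - x)" for k
    using le_a[of k] unfolding b by (simp add: q_def xs_def ys_def)
  have b_le': "b k \<le> a + v \<bullet> (xs k - x) - 2 * e * norm (xs k - x)" for k
    using b_le[of k] zero_le_power2[of "norm (L (xs k) - ys k)"]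
    by (smt (verit) divide_nonneg_nonneg mult_nonneg_nonneg of_nat_0_le_iff)
  obtain B where B: "\<And>k. B \<le> b k"
  proof -
    have "cball (L x) \<rho> \<noteq> {}"
      using \<rho> by simp
    then obtain y0 where y0: "\<And>z. z \<in> cball (L x) \<rho> \<Longrightarrow> g y0 \<le> g z"
      using lsc_attains_min[OF assms(2) compact_cball] by blast
    have "g y0 \<le> ereal (b k)" for k
      using y0[OF ys[of k]] by (simp add: b)
    moreover have "g y0 > -\<infinity>"
      using assms(1) by (simp add: proper_def)
    ultimately show thesis
      by (cases "g y0") (use that in auto)
  qed
  obtain l \<tau> where \<tau>: "strict_mono \<tau>" "(zs \<circ> \<tau>) \<longlonglongrightarrow> l"
    using K(1)[unfolded compact_def, THEN spec, of zs] zsK by blast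
  have xl: "(\<lambda>k. xs (\<tau> k)) \<longlonglongrightarrow> fst l" and yl: "(\<lambda>k. ys (\<tau> k)) \<longlonglongrightarrow> snd l"
    using tendsto_fst[OF \<tau>(2)] tendsto_snd[OF \<tau>(2)] by (simp_all add: xs_def ys_def comp_def)
  have Lxl: "(\<lambda>k. L (xs (\<tau> k))) \<longlonglongrightarrow> L (fst l)"
    using continuous_on_tendsto_compose[OF contL[of UNIV] xl] by simp
  \<comment> \<open>Since \<open>g\<close> is bounded below on the ball, the penalties stay bounded,
    so the squared residuals are of order \<open>1 / k\<close>.\<close>
  have "snd l = L (fst l)"
  proof -
    define M where "M = a - B + norm v * \<rho>"
    have pen: "(norm (L (xs k) - ys k))\<^sup>2 \<le> 2 * M / real k" if "k > 0" for k
    proof -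
      have "v \<bullet> (xs k - x) \<le> norm v * norm (xs k - x)"
        by (rule norm_cauchy_schwarz)
      also have "\<dots> \<le> norm v * \<rho>"
        using xs[of k] by (intro mult_left_mono) (auto simp: dist_norm)
      finally have "v \<bullet> (xs k - x) \<le> norm v * \<rho>" .
      moreover have "0 \<le> 2 * e * norm (xs k - x)"
        using e by simp
      ultimately have "real k / 2 * (norm (L (xs k) - ys k))\<^sup>2 \<le> M"
        using b_le[of k] B[of k] unfolding M_def by linarith
      then show ?thesis
        using that by (simp add: field_simps)
    qed
    have "(\<lambda>k. 2 * M / real k) \<longlonglongrightarrow> 0"
      by (rule lim_const_over_n)
    then have "(\<lambda>k. 2 * M / real (\<tau> k)) \<longlonglongrightarrow> 0"
      using LIMSEQ_subseq_LIMSEQ[OF _ \<tau>(1)] by (fastforce simp: comp_def)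
    moreover have "(\<lambda>k. (norm (L (xs (\<tau> k)) - ys (\<tau> k)))\<^sup>2) \<longlonglongrightarrow> (norm (L (fst l) - snd l))\<^sup>2"
      by (intro tendsto_intros Lxl yl)
    moreover have "\<forall>\<^sub>F k in sequentially. (norm (L (xs (\<tau> k)) - ys (\<tau> k)))\<^sup>2 \<le> 2 * M / real (\<tau> k)"
      \<comment> \<open>Index 0 carries no penalty and division by it gives 0, so
        \<open>\<tau> k\<close> must be positive.\<close>
      using eventually_gt_at_top[of 0]
    proof eventually_elim
      case (elim k)
      then have "0 < \<tau> k"
        using seq_suble[OF \<tau>(1), of k] by linarith
      then show ?case
        by (rule pen)
    qed
    ultimately have "(norm (L (fst l) - snd l))\<^sup>2 \<le> 0"
      by (intro tendsto_le[OF sequentially_bot])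
    then show ?thesis
      by simp
  qed
  have bound: "(\<lambda>k. ereal (a + v \<bullet> (xs (\<tau> k) - x) - 2 * e * norm (xs (\<tau> k) - x)))
      \<longlonglongrightarrow> ereal (a + v \<bullet> (fst l - x) - 2 * e * norm (fst l - x))"
    by (intro tendsto_intros tendsto_ereal xl)
  \<comment> \<open>Lower semicontinuity bounds \<open>g\<close> at the limit above with coefficient
    \<open>2 * e\<close>, and \<open>below\<close> bounds it below with coefficient
    \<open>e\<close>; both can hold only if \<open>fst l = x\<close>.\<close>
  have "g (snd l) \<le> ereal (a + v \<bullet> (fst l - x) - 2 * e * norm (fst l - x))"
    by (rule lsc_sequence_le[OF assms(2) yl bound]) (simp add: b b_le')
  moreover have "fst l \<in> cball x \<rho>"
    using tendsto_upperbound[OF tendsto_dist[OF xl tendsto_const[of x]], of \<rho>] xs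
    by (simp add: dist_commute)
  ultimately have "a + (v \<bullet> (fst l - x) - e * norm (fst l - x))
      \<le> a + v \<bullet> (fst l - x) - 2 * e * norm (fst l - x)"
    using below[of "fst l"] \<open>snd l = L (fst l)\<close> by (metis ereal_less_eq(3) order_trans)
  then have "e * norm (fst l - x) \<le> 0"
    by simp
  then have l: "fst l = x" "snd l = L x"
    using e \<open>snd l = L (fst l)\<close> by (auto simp: mult_le_0_iff)
  have "(\<lambda>k. a + v \<bullet> (xs (\<tau> k) - x) - 2 * e * norm (xs (\<tau> k) - x)) \<longlonglongrightarrow> a"
    using bound by (simp add: l)
  then have "\<forall>\<^sub>F k in sequentially. a + v \<bullet> (xs (\<tau> k) - x) - 2 * e * norm (xs (\<tau> k) - x) < a + \<eta>"
    by (rule order_tendstoD) (use assms(5) in simp)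
  moreover have "\<forall>\<^sub>F k in sequentially. dist (xs (\<tau> k)) x < min \<eta> \<rho>"
    and "\<forall>\<^sub>F k in sequentially. dist (ys (\<tau> k)) (L x) < min \<eta> \<rho>"
    using tendstoD[OF xl, of "min \<eta> \<rho>"] tendstoD[OF yl, of "min \<eta> \<rho>"] \<rho> assms(5)
    by (simp_all add: l)
  ultimately have "\<forall>\<^sub>F k in sequentially. b (\<tau> k) < a + \<eta> \<and> dist (xs (\<tau> k)) x < min \<eta> \<rho> \<and>
      dist (ys (\<tau> k)) (L x) < min \<eta> \<rho>"
    by eventually_elim (auto intro: le_less_trans[OF b_le'])
  then obtain k where k: "b k < a + \<eta>" "dist (xs k) x < \<eta>" "dist (xs k) x < \<rho>"
    "dist (ys k) (L x) < \<eta>" "dist (ys k) (L x) < \<rho>"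
    by (auto dest: eventually_happens'[OF sequentially_bot])
  define w where "w = L (xs k) - ys k"
  define u where "u = real k *\<^sub>R w"
  have q_zs: "q k (zs k) = - (v \<bullet> (xs k - x)) + 2 * e * norm (xs k - x) + real k / 2 * (norm w)\<^sup>2"
    by (simp add: q_def xs_def ys_def w_def)
  \<comment> \<open>The first component is fixed at \<open>xs k\<close> and only the second varies.
    Expanding the penalty gives the slope \<open>u\<close> and the curvature
    \<open>real k / 2\<close>.\<close>
  have sub: "u \<in> regular_subdiff g (ys k)"
  proof (rule proximal_subgradient_regular[of _ _ "\<rho> - dist (ys k) (L x)" _ "real k / 2"])
    fix y
    assume "dist y (ys k) < \<rho> - dist (ys k) (L x)"
    then have "(xs k, y) \<in> K"
      using dist_triangle[of y "L x" "ys k"] xs[of k] by (auto simp: K_def dist_commute)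
    then have "ereal (b k) + ereal (q k (zs k)) \<le> g y + ereal (q k (xs k, y))"
      using zs_min[of "(xs k, y)" k] by (simp add: b[symmetric] ys_def)
    moreover have "q k (zs k) - q k (xs k, y) = u \<bullet> (y - ys k) - real k / 2 * (norm (y - ys k))\<^sup>2"
    proof -
      have eq: "L (xs k) - y = w - (y - ys k)"
        by (simp add: w_def)
      show ?thesis
        unfolding q_zs unfolding q_def fst_conv snd_conv eq power2_norm_diff[of w] u_def inner_scaleR_left
        by argo
    qed
    ultimately show "g (ys k) + ereal (u \<bullet> (y - ys k) - real k / 2 * (norm (y - ys k))\<^sup>2) \<le> g y"
      by (cases "g y") (auto simp: b)
  qed (use k in \<open>simp_all add: b\<close>)
  \<comment> \<open>Now only the first component varies, along the residual \<open>d\<close> itself.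
    For small \<open>t > 0\<close> the objective changes to first order by at most
    \<open>t * (2 * e * norm d - norm d * norm d)\<close>, which minimality makes nonnegative. The
    norm term may fail to be differentiable, so the triangle inequality bounds it.\<close>
  define d where "d = v - adjoint L u"
  have "norm d * norm d \<le> 2 * e * norm d"
  proof -
    \<comment> \<open>The bound on \<open>t\<close> keeps the competitor in \<open>K\<close>; adding
      1 avoids division by zero when \<open>d = 0\<close>.\<close>
    have step: "norm d * norm d \<le> 2 * e * norm d + t * (real k / 2 * (norm (L d))\<^sup>2)"
      if t: "0 < t" "t < (\<rho> - dist (xs k) x) / (norm d + 1)" for t
    proof -
      have "t * norm d \<le> t * (norm d + 1)"
        using t by simp
      also have "\<dots> < \<rho> - dist (xs k) x"
        using t by (simp add: pos_less_divide_eq add_nonneg_pos)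
      finally have td: "norm (xs k + t *\<^sub>R d - x) \<le> \<rho>"
        using norm_triangle_ineq[of "xs k - x" "t *\<^sub>R d"] t by (simp add: dist_norm algebra_simps)
      then have "(xs k + t *\<^sub>R d, ys k) \<in> K"
        using ys by (auto simp: K_def dist_norm norm_minus_commute)
      then have "ereal (b k + q k (zs k)) \<le> ereal (b k + q k (xs k + t *\<^sub>R d, ys k))"
        using zs_min[of "(xs k + t *\<^sub>R d, ys k)" k] by (simp add: b[symmetric] ys_def flip: plus_ereal.simps(1))
      then have "q k (zs k) \<le> q k (xs k + t *\<^sub>R d, ys k)"
        by simp
      moreover have "q k (xs k + t *\<^sub>R d, ys k) = - (v \<bullet> (xs k - x)) - t * (v \<bullet> d)
          + 2 * e * norm ((xs k - x) + t *\<^sub>R d)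
          + real k / 2 * ((norm w)\<^sup>2 + 2 * t * (w \<bullet> L d) + t\<^sup>2 * (norm (L d))\<^sup>2)"
      proof -
        have eqs: "L (xs k + t *\<^sub>R d) - ys k = w - (- t) *\<^sub>R L d" "xs k + t *\<^sub>R d - x = (xs k - x) + t *\<^sub>R d"
          by (simp_all add: w_def linear_add[OF assms(3)] linear_scale[OF assms(3)])
        show ?thesis
          unfolding q_def fst_conv snd_conv eqs power2_norm_diff
          by (simp add: inner_add_right power_mult_distrib algebra_simps)
      qed
      moreover have "2 * e * norm ((xs k - x) + t *\<^sub>R d) \<le> 2 * e * norm (xs k - x) + t * (2 * e * norm d)"
        using mult_left_mono[OF norm_triangle_ineq[of "xs k - x" "t *\<^sub>R d"], of "2 * e"] e t
        by (simp add: algebra_simps)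
      moreover have "v \<bullet> d = d \<bullet> d + real k * (w \<bullet> L d)"
      proof -
        have "adjoint L u \<bullet> d = u \<bullet> L d"
          using adjoint_works[OF assms(3), of d u] by (simp add: inner_commute)
        then show ?thesis
          by (simp add: d_def u_def inner_diff_left)
      qed
      ultimately have "t * (d \<bullet> d) \<le> t * (2 * e * norm d) + t * (t * (real k / 2 * (norm (L d))\<^sup>2))"
        unfolding q_zs by (simp add: algebra_simps power2_eq_square)
      then have "t * (d \<bullet> d) \<le> t * (2 * e * norm d + t * (real k / 2 * (norm (L d))\<^sup>2))"
        by (simp only: distrib_left)
      then show ?thesis
        using t(1) by (simp add: power2_norm_eq_inner[symmetric] power2_eq_square)
    qed
    have "0 < (\<rho> - dist (xs k) x) / (norm d + 1)"
      using k by (simp add: add_nonneg_pos)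
    then have "\<forall>\<^sub>F t in at_right 0. norm d * norm d
        \<le> 2 * e * norm d + t * (real k / 2 * (norm (L d))\<^sup>2)"
      unfolding eventually_at_right_field using step by blast
    moreover have "((\<lambda>t. 2 * e * norm d + t * (real k / 2 * (norm (L d))\<^sup>2))
        \<longlongrightarrow> 2 * e * norm d + 0 * (real k / 2 * (norm (L d))\<^sup>2)) (at_right 0)"
      by (intro tendsto_intros)
    ultimately have "norm d * norm d \<le> 2 * e * norm d + 0 * (real k / 2 * (norm (L d))\<^sup>2)"
      by (intro tendsto_lowerbound) auto
    then show ?thesis
      by simp
  qed
  then have "norm d \<le> \<eta>"
    using assms(5) by (cases "d = 0") (auto simp: e_def)
  moreover have "0 \<le> u \<bullet> (L (xs k) - ys k)"
    by (simp add: u_def w_def)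
  moreover have "g (ys k) < g (L x) + ereal \<eta>"
    using k(1) by (simp add: a b)
  ultimately show thesis
    using that k sub unfolding d_def by blast
qed

section \<open>Composition with a linear map\<close>

text \<open>The fuzzy chain rule, applied with errors \<open>1 / real (Suc k)\<close>, gives
  subgradients \<open>us k\<close> of \<open>g\<close> whose adjoint images tend to
  \<open>w\<close>. The uniform inequality for \<open>g\<close> is used at the test point
  \<open>L z\<close>, rewritten through the adjoint, and passed to the limit.\<close>

lemma local_subgradient_ineq_compose:
  fixes g :: "'b::euclidean_space \<Rightarrow> ereal" and L :: "'a::euclidean_space \<Rightarrow> 'b"
  assumes "proper g" and "lsc g" and L: "linear L" and "\<bar>g (L x)\<bar> \<noteq> \<infinity>"
    and "\<And>u. u \<in> limiting_subdiff g (L x) \<Longrightarrow> adjoint L u = v \<Longrightarrow> local_subgradient_ineq g (L x) u"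
    and "\<And>u. u \<in> horizon_subdiff g (L x) \<Longrightarrow> adjoint L u = 0 \<Longrightarrow> u = 0"
  shows "local_subgradient_ineq (\<lambda>x. g (L x)) x v"
proof -
  obtain \<delta> where \<delta>: "\<delta> > 0" "\<And>y u z. dist y (L x) < \<delta> \<Longrightarrow> g y < g (L x) + ereal \<delta> \<Longrightarrow>
      dist (adjoint L u) v < \<delta> \<Longrightarrow> dist z (L x) < \<delta> \<Longrightarrow> u \<in> regular_subdiff g y \<Longrightarrow>
      g y + ereal (u \<bullet> (z - y)) \<le> g z"
    using uniform_local_subgradient_ineq[OF assms(2) adjoint_linear[OF L] assms(4-6)] by blast
  obtain a where a: "g (L x) = ereal a"
    using assms(4) by (metis ereal_real)
  obtain B where B: "B > 0" "\<And>z. norm (L z) \<le> B * norm z"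
    using linear_bounded_pos[OF L] by blast
  \<comment> \<open>The bound \<open>\<delta> / B\<close> makes \<open>L\<close> send the ball of
    radius \<open>r\<close> about \<open>x\<close> into the ball of radius \<open>\<delta>\<close>
    about \<open>L x\<close>.\<close>
  define r where "r = min (\<delta> / 2) (\<delta> / B)"
  have r: "r > 0" "r \<le> \<delta> / 2" "B * r \<le> \<delta>"
    using \<delta>(1) B(1) by (auto simp: r_def min_def field_simps)
  have L_close: "dist (L z) (L x) < \<delta>" if "dist z x < r" for z
  proof -
    have "dist (L z) (L x) \<le> B * dist z x"
      using B(2)[of "z - x"] by (simp add: dist_norm linear_diff[OF L])
    also have "\<dots> < B * r"
      using that B(1) by simp
    finally show ?thesis
      using r(3) by simp
  qed
  have "g (L y) + ereal (w \<bullet> (z - y)) \<le> g (L z)"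
    if y: "dist y x < r" "g (L y) < g (L x) + ereal r" and w: "dist w v < r" and z: "dist z x < r"
      and sub: "w \<in> regular_subdiff (\<lambda>x. g (L x)) y" for y w z
  proof -
    have "\<exists>x' y' u. dist x' y < 1 / real (Suc k) \<and> dist y' (L y) < 1 / real (Suc k) \<and>
        g y' < g (L y) + ereal (1 / real (Suc k)) \<and> u \<in> regular_subdiff g y' \<and>
        norm (w - adjoint L u) \<le> 1 / real (Suc k) \<and> 0 \<le> u \<bullet> (L x' - y')" for k
      by (rule fuzzy_chain_rule[OF assms(1,2) L sub, of "1 / real (Suc k)"]) (simp, blast)
    then obtain xs ys us where xs: "\<And>k. dist (xs k) y < 1 / real (Suc k)"
      and ys: "\<And>k. dist (ys k) (L y) < 1 / real (Suc k)"
      and gys: "\<And>k. g (ys k) < g (L y) + ereal (1 / real (Suc k))"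
      and us: "\<And>k. us k \<in> regular_subdiff g (ys k)"
      and Lus: "\<And>k. norm (w - adjoint L (us k)) \<le> 1 / real (Suc k)"
      and pos: "\<And>k. 0 \<le> us k \<bullet> (L (xs k) - ys k)"
      by metis
    have fin: "\<bar>g (L y)\<bar> \<noteq> \<infinity>"
      using sub by (simp add: regular_subdiff_iff)
    have xs_lim: "xs \<longlonglongrightarrow> y" and ys_lim: "ys \<longlonglongrightarrow> L y"
      by (rule LIMSEQ_dist_inverse_Suc, intro less_imp_le xs ys)+
    have us_lim: "(\<lambda>k. adjoint L (us k)) \<longlonglongrightarrow> w"
      using Lus by (intro LIMSEQ_dist_inverse_Suc) (simp add: dist_norm norm_minus_commute del: of_nat_Suc)
    have gys_lim: "(\<lambda>k. g (ys k)) \<longlonglongrightarrow> g (L y)"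
      by (intro lsc_tendsto_inverse_Suc[OF assms(2) ys_lim] less_imp_le gys)
    have "\<forall>\<^sub>F k in sequentially. g (ys k) + ereal (adjoint L (us k) \<bullet> (z - xs k)) \<le> g (L z)"
    proof -
      have "dist (L y) (L x) < \<delta>" "g (L y) < g (L x) + ereal \<delta>" "dist w v < \<delta>"
        using L_close[OF y(1)] w r(2) \<delta>(1) less_le_trans[OF y(2), of "g (L x) + ereal \<delta>"]
        by (simp_all add: a)
      then have "\<forall>\<^sub>F k in sequentially. dist (ys k) (L x) < \<delta>"
        and "\<forall>\<^sub>F k in sequentially. g (ys k) < g (L x) + ereal \<delta>"
        and "\<forall>\<^sub>F k in sequentially. dist (adjoint L (us k)) v < \<delta>"
        using order_tendstoD(2)[OF tendsto_dist[OF ys_lim tendsto_const]]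
          order_tendstoD(2)[OF gys_lim] order_tendstoD(2)[OF tendsto_dist[OF us_lim tendsto_const]]
        by auto
      then show ?thesis
      proof eventually_elim
        case (elim k)
        have "g (ys k) + ereal (us k \<bullet> (L z - ys k)) \<le> g (L z)"
          using elim L_close[OF z] us by (rule \<delta>(2))
        \<comment> \<open>The two sides differ by exactly
          \<open>us k \<bullet> (L (xs k) - ys k)\<close>, which is nonnegative by
          \<open>pos\<close>.\<close>
        moreover have "adjoint L (us k) \<bullet> (z - xs k) \<le> us k \<bullet> (L z - ys k)"
          using adjoint_works[OF L, of "z - xs k" "us k"] pos[of k]
          by (simp add: inner_commute linear_diff[OF L] inner_diff_right)
        ultimately show ?case
          by (meson add_left_mono ereal_less_eq(3) order_trans)
      qed
    qed
    moreover have "(\<lambda>k. g (ys k) + ereal (adjoint L (us k) \<bullet> (z - xs k)))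
        \<longlonglongrightarrow> g (L y) + ereal (w \<bullet> (z - y))"
      by (intro tendsto_add_ereal_general tendsto_ereal tendsto_intros gys_lim us_lim xs_lim) (simp add: fin)
    ultimately show ?thesis
      by (intro tendsto_upperbound) auto
  qed
  with r(1) show ?thesis
    unfolding local_subgradient_ineq_def by blast
qed

theorem theorem4p4:
  fixes g :: "real ^ 'm \<Rightarrow> ereal"
    and A :: "real ^ 'n ^ 'm"
    and f :: "real ^ 'n \<Rightarrow> ereal"
    and x v :: "real ^ 'n"
  assumes "proper g" and "lsc g"
    and "f = (\<lambda>y. g (A *v y))"
    and "x \<in> (\<lambda>y. A *v y) -` domf g"
    and "v \<in> limiting_subdiff f x"
    and "\<And>u. u \<in> limiting_subdiff g (A *v x) \<Longrightarrow> v = transpose A *v u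
            \<Longrightarrow> variationally_convex g (A *v x) u"
    and "{u. transpose A *v u = 0} \<inter> horizon_subdiff g (A *v x) = {0}"
  shows "variationally_convex f x v"
proof (rule local_subgradient_ineq_imp_variationally_convex)
  \<comment> \<open>Membership of \<open>v\<close> in the limiting subdifferential of
    \<open>f\<close> already includes finiteness of \<open>f x\<close>.\<close>
  have fin: "\<bar>g (A *v x)\<bar> \<noteq> \<infinity>"
    using assms(3,5) by (simp add: limiting_subdiff_def)
  show "proper f"
    using assms(1,4) unfolding assms(3) by (auto simp: proper_def domf_def intro!: exI[of _ x])
  show "lsc f"
    unfolding assms(3) by (rule lsc_compose[OF assms(2)]) (rule matrix_vector_mult_linear_continuous_on)
  show "v \<in> limiting_subdiff f x"
    by fact
  show "local_subgradient_ineq f x v"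
    unfolding assms(3)
    by (rule local_subgradient_ineq_compose[OF assms(1,2) matrix_vector_mul_linear fin])
      (use assms(6,7) in \<open>auto simp: adjoint_matrix intro: variationally_convex_imp_local_subgradient_ineq\<close>)
qed

end
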